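(* The set of all sense-preserving circle homeomorphisms of the form $B_1/B_2$ (restricted to $\mathbb{T}$), where $B_1,B_2$ are finite Blaschke products, is connected as a subset of $C(\mathbb{T})$ with the uniform norm topology.
   Context: $\mathbb{T}=\{z\in\mathbb{C}\colon |z|=1\}$ and $\mathbb{D}=\{z\in\mathbb{C}\colon |z|<1\}$. A circle homeomorphism is a homeomorphism of $\mathbb{T}$ onto itself. $C(\mathbb{T})$ is the space of continuous maps $\mathbb{T}\to\mathbb{C}$ with the topology of the norm $\|f\|=\sup_{\mathbb{T}}|f|$. A finite Blaschke product (of degree $n\ge 0$) is a rational function of the form $B(z)=\sigma\prod_{k=1}^n\frac{z-z_k}{1-\overline{z_k}z}$ with $z_1,\dots,z_n\in\mathbb{D}$ (not necessarily distinct) and $\sigma\in\mathbb{T}$; for $n=0$ it is the constant $\sigma$. The degrees of $B_1$ and $B_2$ are not fixed. *)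

theory Defs
  imports "HOL-Analysis.Analysis"
begin

abbreviation unit_circle :: "complex set" where
  "unit_circle \<equiv> sphere 0 1"

text \<open>Division by zero makes the value \<open>0\<close> at the poles of a factor, which lie outside the closed disc;
  on the unit circle no denominator vanishes.\<close>

definition finite_Blaschke_product :: "(complex \<Rightarrow> complex) \<Rightarrow> bool" where
  "finite_Blaschke_product B \<longleftrightarrow>
    (\<exists>(n::nat) (\<sigma>::complex) (a::nat \<Rightarrow> complex).
        \<sigma> \<in> unit_circle \<and> (\<forall>k\<in>{1..n}. a k \<in> ball 0 1) \<and>
        B = (\<lambda>z. \<sigma> * (\<Prod>k=1..n. (z - a k) / (1 - cnj (a k) * z))))"

definition circle_homeomorphism :: "(complex \<Rightarrow> complex) \<Rightarrow> bool" where
  "circle_homeomorphism f \<longleftrightarrow> (\<exists>g. homeomorphism unit_circle unit_circle f g)"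

text \<open>A circle homeomorphism preserves the sense if it lifts, through the covering \<open>cis\<close>,
  to an increasing self-map of the line (every continuous lift is strictly monotone).\<close>

definition sense_preserving_circle_homeomorphism :: "(complex \<Rightarrow> complex) \<Rightarrow> bool" where
  "sense_preserving_circle_homeomorphism f \<longleftrightarrow>
    circle_homeomorphism f \<and>
    (\<exists>\<phi>::real \<Rightarrow> real. continuous_on UNIV \<phi> \<and> strict_mono \<phi> \<and> (\<forall>t. f (cis t) = cis (\<phi> t)))"

text \<open>The space of continuous complex functions on the circle with the uniform metric.
  Its points are functions restricted to the circle, that is, \<open>undefined\<close> outside it.\<close>

definition C_circle :: "(complex \<Rightarrow> complex) metric" where
  "C_circle = cfunspace (top_of_set unit_circle) euclidean_metric"

definition Blaschke_quotient_homeomorphisms :: "(complex \<Rightarrow> complex) set" where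
  "Blaschke_quotient_homeomorphisms =
    {f. sense_preserving_circle_homeomorphism f \<and>
        (\<exists>B1 B2. finite_Blaschke_product B1 \<and> finite_Blaschke_product B2 \<and>
                 f = (\<lambda>z\<in>unit_circle. B1 z / B2 z))}"

end

theory Submission
  imports Defs "HOL-Complex_Analysis.Conformal_Mappings"
begin

text \<open>
  Let \<open>B1\<close> have zeros \<open>a k\<close> (\<open>1 \<le> k \<le> n\<close>) and \<open>B2\<close> zeros \<open>b k\<close> (\<open>1 \<le> k \<le> m\<close>). On the circle
  \<open>(z - a) / (1 - cnj a * z) = z * cnj w / w\<close> with \<open>w = 1 - cnj a * z\<close> in the right half-plane, so
  \<open>B1 / B2\<close> has the lift \<open>t \<mapsto> c + (n - m) * t + Im (L (cis t))\<close>, where \<open>L\<close> is the sum of the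
  \<open>- 2 * Ln (1 - cnj (a k) * z)\<close> minus that of the \<open>- 2 * Ln (1 - cnj (b k) * z)\<close>, holomorphic on the
  closed disc. Being a sense-preserving homeomorphism means that \<open>n = m + 1\<close> and the lift increases.
  Multiplying all zeros by \<open>r \<in> [0, 1]\<close> replaces \<open>L (cis t)\<close> by \<open>L (r * cis t)\<close>, and by the maximum
  principle the lift still increases. This gives a path inside the set from \<open>B1 / B2\<close> at \<open>r = 1\<close>
  to a rotation at \<open>r = 0\<close>, and the rotations form a connected set.
\<close>

section \<open>Connected sets of continuous functions\<close>

text \<open>A jointly continuous \<open>F\<close> on the compact \<open>K \<times> S\<close> is
  uniformly continuous, so the curried map from \<open>K\<close> is continuous for the sup metric.
  Applied with \<open>K\<close> the circle (rotations) and \<open>K = {0..1}\<close> (the path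
  scaling the zeros).\<close>

lemma connectedin_cfunspace_image:
  fixes F :: "'a::metric_space \<Rightarrow> 'b::metric_space \<Rightarrow> 'c::metric_space"
  assumes K: "compact K" "connected K" and S: "compact S"
    and F: "continuous_on (K \<times> S) (\<lambda>(t, z). F t z)"
  shows "connectedin (mtopology_of (cfunspace (top_of_set S) euclidean_metric))
           ((\<lambda>t. \<lambda>z\<in>S. F t z) ` K)"
proof -
  define m where "m = cfunspace (top_of_set S) (euclidean_metric :: 'c metric)"
  interpret Metric_space "mspace m" "mdist m" by simp
  have FS: "continuous_on S (F t)" if "t \<in> K" for t
  proof -
    have "continuous_on S (\<lambda>z. case (t, z) of (t, z) \<Rightarrow> F t z)"
      using that by (intro continuous_on_compose2[OF F] continuous_intros) auto
    then show ?thesis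
      by simp
  qed
  \<comment> \<open>Points of \<open>cfunspace\<close> are bounded; compactness of \<open>S\<close>
    provides this.\<close>
  have in_m: "(\<lambda>z\<in>S. F t z) \<in> mspace m" if "t \<in> K" for t
    using FS[OF that] S
    by (simp add: m_def compactin_mspace_cfunspace compactin_subtopology del: mspace_cfunspace
        cong: continuous_on_cong)
  have unif: "uniformly_continuous_on (K \<times> S) (\<lambda>(t, z). F t z)"
    using F K S by (intro compact_uniformly_continuous compact_Times)
  have "continuous_map (top_of_set K) mtopology (\<lambda>t. \<lambda>z\<in>S. F t z)"
    unfolding continuous_map_to_metric
  proof (intro ballI allI impI)
    fix t :: 'a and e :: real
    assume "t \<in> topspace (top_of_set K)" and e: "e > 0"
    then have t: "t \<in> K" by simp
    \<comment> \<open>Half of \<open>e\<close>, because passing to the supremum keeps only a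
      non-strict bound.\<close>
    obtain d where d: "d > 0" and
      dF: "\<And>p q. p \<in> K \<times> S \<Longrightarrow> q \<in> K \<times> S \<Longrightarrow> dist q p < d \<Longrightarrow>
            dist (case q of (t, z) \<Rightarrow> F t z) (case p of (t, z) \<Rightarrow> F t z) < e / 2"
      using unif e unfolding uniformly_continuous_on_def by (metis half_gt_zero)
    have "(\<lambda>z\<in>S. F s z) \<in> mball (\<lambda>z\<in>S. F t z) e" if s: "s \<in> K \<inter> ball t d" for s
    proof -
      have "dist (F t z) (F s z) \<le> e / 2" if "z \<in> S" for z
        using dF[of "(s, z)" "(t, z)"] s t that by (auto simp: dist_Pair_Pair)
      then have "mdist m (\<lambda>z\<in>S. F t z) (\<lambda>z\<in>S. F s z) \<le> e / 2"
        unfolding m_def using e by (intro mdist_cfunspace_le) auto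
      then show ?thesis
        using in_m s t e by simp
    qed
    then show "\<exists>U. openin (top_of_set K) U \<and> t \<in> U \<and>
                 (\<forall>s\<in>U. (\<lambda>z\<in>S. F s z) \<in> mball (\<lambda>z\<in>S. F t z) e)"
      using t d by (intro exI[of _ "K \<inter> ball t d"]) auto
  qed
  then have "connectedin mtopology ((\<lambda>t. \<lambda>z\<in>S. F t z) ` K)"
    using K by (intro connectedin_continuous_map_image) (auto simp: connectedin_subtopology)
  then show ?thesis
    by (simp add: m_def mtopology_of_def)
qed

section \<open>Lifts of circle homeomorphisms\<close>

lemma unit_circle_cis:
  assumes "z \<in> unit_circle"
  obtains t where "0 \<le> t" "t < 2 * pi" "z = cis t"
proof -
  have "z = cis (Arg2pi z)"
    using assms complex_norm_eq_1_exp[of z] by (simp add: cis_conv_exp)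
  then show thesis
    using that Arg2pi_ge_0 Arg2pi_lt_2pi by blast
qed

lemma cis_eq_imp_eq:
  assumes "cis s = cis t" "\<bar>s - t\<bar> < 2 * pi"
  shows "s = t"
proof -
  obtain k :: int where k: "s = t + 2 * pi * k"
    using assms(1) sin_cos_eq_iff[of s t] by (auto simp: complex_eq_iff)
  then have "2 * pi * \<bar>real_of_int k\<bar> < 2 * pi * 1"
    using assms(2) by (simp add: abs_mult)
  then have "\<bar>real_of_int k\<bar> < 1"
    by (subst (asm) mult_less_cancel_left_pos) auto
  then show ?thesis
    using k by simp
qed

text \<open>The difference is continuous, and any two distinct values of it are at least 2 pi apart,
  so it is constant on the connected line. This carries monotonicity from an abstract lift to an
  explicit one.\<close>

lemma cis_lifts_differ_by_constant:
  fixes \<phi> \<psi> :: "real \<Rightarrow> real"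
  assumes "continuous_on UNIV \<phi>" "continuous_on UNIV \<psi>" "\<And>t. cis (\<phi> t) = cis (\<psi> t)"
  obtains c where "\<And>t. \<psi> t = \<phi> t + c"
proof -
  have "(\<lambda>t. \<psi> t - \<phi> t) constant_on UNIV"
  proof (rule continuous_discrete_range_constant)
    fix s :: real
    have "2 * pi \<le> norm ((\<psi> t - \<phi> t) - (\<psi> s - \<phi> s))"
      if "\<psi> t - \<phi> t \<noteq> \<psi> s - \<phi> s" for t
    proof (rule ccontr)
      assume "\<not> ?thesis"
      moreover have "cis (\<psi> t - \<phi> t) = cis (\<psi> s - \<phi> s)"
        by (simp add: assms(3) flip: cis_divide)
      ultimately show False
        using that cis_eq_imp_eq[of "\<psi> t - \<phi> t" "\<psi> s - \<phi> s"] by auto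
    qed
    then show "\<exists>e>0. \<forall>t. t \<in> UNIV \<and> \<psi> t - \<phi> t \<noteq> \<psi> s - \<phi> s \<longrightarrow>
        e \<le> norm (\<psi> t - \<phi> t - (\<psi> s - \<phi> s))"
      by (intro exI[of _ "2 * pi"]) auto
  qed (auto intro!: continuous_intros assms)
  then obtain c where "\<And>t. \<psi> t - \<phi> t = c"
    by (auto simp: constant_on_def)
  then show thesis
    using that[of c] by (simp add: algebra_simps)
qed

text \<open>By \<open>turn\<close>, one period is mapped onto an interval of length exactly 2 pi: it
  is too short for \<open>f\<close> to repeat a value and long enough to reach every point. The
  inverse is continuous by compactness.\<close>

lemma sense_preserving_circle_homeomorphismI:
  assumes f: "continuous_on unit_circle f" and lift: "\<And>t. f (cis t) = cis (\<psi> t)"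
    and cont: "continuous_on UNIV \<psi>" and mono: "strict_mono \<psi>"
    and turn: "\<psi> (2 * pi) = \<psi> 0 + 2 * pi"
  shows "sense_preserving_circle_homeomorphism f"
proof -
  have range: "\<psi> 0 \<le> \<psi> t \<and> \<psi> t < \<psi> 0 + 2 * pi" if "0 \<le> t" "t < 2 * pi" for t
    using strict_mono_less[OF mono, of t "2 * pi"] strict_mono_less_eq[OF mono, of 0 t] that turn
    by simp
  have inj: "inj_on f unit_circle"
  proof (rule inj_onI)
    fix x y assume "x \<in> unit_circle" "y \<in> unit_circle" and eq: "f x = f y"
    then obtain s t where st: "0 \<le> s" "s < 2 * pi" "x = cis s" "0 \<le> t" "t < 2 * pi" "y = cis t"
      by (metis unit_circle_cis)
    have "\<psi> s = \<psi> t"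
      using eq range[of s] range[of t] st by (intro cis_eq_imp_eq) (auto simp: lift)
    then show "x = y"
      using st strict_mono_eq[OF mono] by simp
  qed
  have surj: "f ` unit_circle = unit_circle"
  proof (intro equalityI subsetI)
    fix y assume "y \<in> f ` unit_circle"
    then show "y \<in> unit_circle"
      by (auto elim!: unit_circle_cis simp: lift)
  next
    fix y assume "y \<in> unit_circle"
    then have y: "cis (Arg2pi (y / cis (\<psi> 0))) = y / cis (\<psi> 0)"
      using complex_norm_eq_1_exp[of "y / cis (\<psi> 0)"] by (simp add: cis_conv_exp norm_divide)
    \<comment> \<open>Measuring the argument of \<open>y\<close> from \<open>\<psi> 0\<close> places
      \<open>u\<close> in the range of the intermediate value theorem.\<close>
    define u where "u = \<psi> 0 + Arg2pi (y / cis (\<psi> 0))"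
    have "\<psi> 0 \<le> u" "u \<le> \<psi> (2 * pi)"
      using Arg2pi_ge_0 Arg2pi_lt_2pi[of "y / cis (\<psi> 0)"] by (auto simp: u_def turn)
    then obtain t where "\<psi> t = u"
      using IVT'[of \<psi> 0 u "2 * pi"] cont continuous_on_subset by fastforce
    then have "f (cis t) = cis (\<psi> 0) * cis (Arg2pi (y / cis (\<psi> 0)))"
      by (simp add: lift u_def cis_mult)
    also have "\<dots> = y"
      by (simp add: y)
    finally show "y \<in> f ` unit_circle"
      by (metis dist_0_norm image_eqI mem_sphere norm_cis)
  qed
  have "circle_homeomorphism f"
    unfolding circle_homeomorphism_def
    using homeomorphism_compact[OF _ f surj inj] by simp
  then show ?thesis
    unfolding sense_preserving_circle_homeomorphism_def using lift cont mono by blast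
qed

text \<open>An increasing lift forces \<open>d\<close> to be positive. If \<open>d\<close> exceeded
  1, the value \<open>\<psi> 0 + 2 * pi\<close> would be taken strictly between 0 and 2 pi, against
  injectivity.\<close>

lemma sense_preserving_circle_homeomorphism_lift:
  fixes d :: int
  assumes f: "sense_preserving_circle_homeomorphism f" and lift: "\<And>t. f (cis t) = cis (\<psi> t)"
    and cont: "continuous_on UNIV \<psi>" and turn: "\<psi> (2 * pi) = \<psi> 0 + 2 * pi * d"
  shows "strict_mono \<psi>" and "d = 1"
proof -
  obtain \<phi> where \<phi>: "continuous_on UNIV \<phi>" "strict_mono \<phi>" "\<And>t. f (cis t) = cis (\<phi> t)"
    using f unfolding sense_preserving_circle_homeomorphism_def by blast
  obtain c where c: "\<And>t. \<psi> t = \<phi> t + c"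
    using cis_lifts_differ_by_constant[OF \<phi>(1) cont] \<phi>(3) lift by metis
  show mono: "strict_mono \<psi>"
    using \<phi>(2) by (simp add: strict_mono_def c)
  have inj: "inj_on f unit_circle"
    using f unfolding sense_preserving_circle_homeomorphism_def circle_homeomorphism_def
      homeomorphism_def by (metis inj_onI)
  have "\<psi> 0 < \<psi> (2 * pi)"
    using mono by (simp add: strict_mono_less)
  then have "d \<ge> 1"
    by (simp add: turn zero_less_mult_iff)
  moreover have "\<not> d > 1"
  proof
    assume "d > 1"
    then have "\<psi> 0 + 2 * pi < \<psi> (2 * pi)"
      by (simp add: turn)
    moreover obtain t where t: "0 \<le> t" "t \<le> 2 * pi" "\<psi> t = \<psi> 0 + 2 * pi"
      using IVT'[of \<psi> 0 "\<psi> 0 + 2 * pi" "2 * pi"] cont calculation continuous_on_subset by fastforce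
    ultimately have "t \<noteq> 0" "t \<noteq> 2 * pi"
      by auto
    moreover have "f (cis t) = f (cis 0)"
      unfolding lift t(3) by (simp flip: cis_mult)
    then have "cis t = cis 0"
      using inj by (auto dest: inj_onD)
    ultimately show False
      using cis_eq_imp_eq[of t 0] t by simp
  qed
  ultimately show "d = 1"
    by simp
qed

text \<open>For \<open>h > 0\<close> the harmonic function \<open>h + Im (L (z * cis h) - L z)\<close> is positive on the unit
  circle by assumption, hence positive on the disc by the maximum principle.\<close>

lemma strict_mono_lift_shrink:
  assumes L: "L holomorphic_on cball 0 1"
    and mono: "strict_mono (\<lambda>t. t + Im (L (cis t)))" and r: "0 \<le> r" "r \<le> 1"
  shows "strict_mono (\<lambda>t. t + Im (L (of_real r * cis t)))"
proof (rule strict_monoI)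
  fix s t :: real assume "s < t"
  define h where "h = t - s"
  \<comment> \<open>The modulus of \<open>F\<close> is the exponential of minus
    \<open>Im (L (z * cis h) - L z)\<close>, so a lower bound for this harmonic function becomes an
    upper bound for the modulus.\<close>
  define F where "F z = exp (\<i> * (L (z * cis h) - L z))" for z
  have norm_F: "norm (F z) = exp (Im (L z) - Im (L (z * cis h)))" for z
    by (simp add: F_def norm_exp_eq_Re)
  have "(\<lambda>z. L (z * cis h)) holomorphic_on cball 0 1"
    by (rule holomorphic_on_compose_gen[OF _ L, unfolded o_def])
      (auto simp: norm_mult intro!: holomorphic_intros)
  then have F: "F holomorphic_on cball 0 1"
    unfolding F_def by (intro holomorphic_intros L)
  have lt: "norm (F z) < exp h" if "z \<in> sphere 0 1" for z
  proof -
    obtain x where x: "z = cis x"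
      using \<open>z \<in> sphere 0 1\<close> by (rule unit_circle_cis)
    show ?thesis
      using strict_monoD[OF mono, of x "x + h"] \<open>s < t\<close>
      by (simp add: norm_F x h_def cis_mult)
  qed
  \<comment> \<open>The maximum over the circle is attained, which keeps the bound
    \<open>exp h\<close> strict inside the disc.\<close>
  have "continuous_on (sphere 0 1) (\<lambda>z. norm (F z))"
    using holomorphic_on_imp_continuous_on[OF F]
    by (intro continuous_on_norm) (auto intro: continuous_on_subset)
  then obtain z0 where z0: "z0 \<in> sphere 0 1" "\<And>z. z \<in> sphere 0 1 \<Longrightarrow> norm (F z) \<le> norm (F z0)"
    using continuous_attains_sup[of "sphere (0::complex) 1" "\<lambda>z. norm (F z)"] by auto
  have "norm (F (r * cis s)) \<le> norm (F z0)"
  proof (rule maximum_modulus_frontier[of F "cball 0 1"])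
    show "F holomorphic_on interior (cball 0 1)"
      by (rule holomorphic_on_subset[OF F]) (simp add: ball_subset_cball)
    show "continuous_on (closure (cball 0 1)) F"
      using holomorphic_on_imp_continuous_on[OF F] by simp
  qed (use z0 r in \<open>auto simp: norm_mult\<close>)
  also have "\<dots> < exp h"
    by (rule lt[OF z0(1)])
  finally show "s + Im (L (r * cis s)) < t + Im (L (r * cis t))"
    by (simp add: norm_F h_def mult.assoc cis_mult)
qed

section \<open>Quotients of finite Blaschke products\<close>

definition blaschke :: "nat \<Rightarrow> (nat \<Rightarrow> complex) \<Rightarrow> complex \<Rightarrow> complex" where
  "blaschke n a z = (\<Prod>k=1..n. (z - a k) / (1 - cnj (a k) * z))"

text \<open>On the circle its imaginary part is an argument of
  \<open>blaschke n a z / z ^ n\<close>. Splitting off the winding part \<open>z ^ n\<close> leaves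
  a function that is single-valued on the whole closed disc.\<close>

definition blaschke_log :: "nat \<Rightarrow> (nat \<Rightarrow> complex) \<Rightarrow> complex \<Rightarrow> complex" where
  "blaschke_log n a z = (\<Sum>k=1..n. - 2 * Ln (1 - cnj (a k) * z))"

lemma finite_Blaschke_product_iff:
  "finite_Blaschke_product B \<longleftrightarrow>
    (\<exists>n \<sigma> a. norm \<sigma> = 1 \<and> (\<forall>k\<in>{1..n}. norm (a k) < 1) \<and> B = (\<lambda>z. \<sigma> * blaschke n a z))"
  by (auto simp: finite_Blaschke_product_def blaschke_def)

lemma Re_blaschke_denominator:
  assumes "norm a < 1" "norm z \<le> 1"
  shows "0 < Re (1 - cnj a * z)"
proof -
  have "norm (cnj a * z) < 1"
    using mult_left_mono[OF assms(2), of "norm a"] assms(1) by (simp add: norm_mult)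
  then show ?thesis
    using complex_Re_le_cmod[of "cnj a * z"] by simp
qed

lemma blaschke_denominator_nonzero:
  assumes "norm a < 1" "norm z \<le> 1"
  shows "1 - cnj a * z \<noteq> 0"
  using Re_blaschke_denominator[OF assms] by (metis less_irrefl zero_complex.sel(1))

lemma holomorphic_blaschke_log:
  assumes "\<forall>k\<in>{1..n}. norm (a k) < 1"
  shows "blaschke_log n a holomorphic_on cball 0 1"
  unfolding blaschke_log_def using Re_blaschke_denominator assms
  by (intro holomorphic_intros) (force simp: complex_nonpos_Reals_iff)

lemma blaschke_factor_cis:
  assumes "norm a < 1"
  shows "(cis t - a) / (1 - cnj a * cis t) = cis (t + Im (- 2 * Ln (1 - cnj a * cis t)))"
proof -
  define w where "w = 1 - cnj a * cis t"
  have w: "w \<noteq> 0"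
    unfolding w_def by (rule blaschke_denominator_nonzero) (use assms in auto)
  have "cis t - a = cis t * cnj w"
    by (simp add: w_def algebra_simps cis_cnj cis_mult)
  \<comment> \<open>The exponent is purely imaginary, so \<open>cnj w / w\<close> is a
    \<open>cis\<close> value.\<close>
  also have "cnj w = exp (cnj (Ln w) - Ln w) * w"
    using w by (simp add: exp_diff flip: exp_cnj)
  also have "exp (cnj (Ln w) - Ln w) = cis (Im (- 2 * Ln w))"
    unfolding cis_conv_exp by (rule arg_cong[of _ _ exp]) (simp add: complex_eq_iff)
  finally have "cis t - a = cis t * cis (Im (- 2 * Ln w)) * w"
    by simp
  then show ?thesis
    using w unfolding w_def[symmetric] by (simp add: cis_mult)
qed

lemma blaschke_cis:
  assumes "\<forall>k\<in>{1..n}. norm (a k) < 1"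
  shows "blaschke n a (cis t) = cis (n * t + Im (blaschke_log n a (cis t)))"
  using assms
proof (induction n)
  case 0
  then show ?case by (simp add: blaschke_def blaschke_log_def)
next
  case (Suc n)
  have "blaschke (Suc n) a (cis t) =
      blaschke n a (cis t) * ((cis t - a (Suc n)) / (1 - cnj (a (Suc n)) * cis t))"
    by (simp add: blaschke_def)
  also have "\<dots> = cis (n * t + Im (blaschke_log n a (cis t))) *
      cis (t + Im (- 2 * Ln (1 - cnj (a (Suc n)) * cis t)))"
    using Suc by (subst blaschke_factor_cis) auto
  also have "\<dots> = cis (Suc n * t + Im (blaschke_log (Suc n) a (cis t)))"
    by (simp add: cis_mult blaschke_log_def algebra_simps)
  finally show ?case .
qed

text \<open>Holds because \<open>r\<close> is real. It turns moving the zeros into evaluation on a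
  smaller circle, as \<open>strict_mono_lift_shrink\<close> requires; \<open>blaschke\<close> itself
  has no such rule.\<close>

lemma blaschke_log_scale: "blaschke_log n (\<lambda>k. of_real r * a k) z = blaschke_log n a (of_real r * z)"
  by (simp add: blaschke_log_def mult_ac)

lemma blaschke_zero: "blaschke n (\<lambda>k. 0) z = z ^ n"
  by (simp add: blaschke_def)

lemma blaschke_quotient_cis:
  assumes "\<forall>k\<in>{1..n}. norm (a k) < 1" "\<forall>k\<in>{1..m}. norm (b k) < 1"
  shows "cis c * blaschke n a (cis t) / blaschke m b (cis t) =
    cis (c + (real n - real m) * t + Im (blaschke_log n a (cis t) - blaschke_log m b (cis t)))"
  using assms by (simp add: blaschke_cis cis_mult cis_divide algebra_simps)

lemma norm_scale_less_1:
  assumes "\<forall>k\<in>{1..n}. norm (a k :: complex) < 1" "0 \<le> r" "r \<le> 1"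
  shows "\<forall>k\<in>{1..n}. norm (of_real r * a k) < 1"
proof
  fix k assume "k \<in> {1..n}"
  then show "norm (of_real r * a k) < 1"
    using assms mult_left_le_one_le[of "norm (a k)" r] by (force simp: norm_mult)
qed

lemma continuous_on_blaschke_scale:
  assumes "\<forall>k\<in>{1..n}. norm (a k) < 1"
  shows "continuous_on ({0..1} \<times> unit_circle) (\<lambda>(r, z). blaschke n (\<lambda>k. of_real r * a k) z)"
  unfolding blaschke_def case_prod_beta
proof (intro continuous_intros ballI)
  fix k p assume "k \<in> {1..n}" "p \<in> {0..1::real} \<times> unit_circle"
  then have "norm (of_real (fst p) * a k) < 1" "norm (snd p) \<le> 1"
    using norm_scale_less_1[OF assms, of "fst p"] by auto
  then show "1 - cnj (of_real (fst p) * a k) * snd p \<noteq> 0"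
    by (rule blaschke_denominator_nonzero)
qed

lemma norm_blaschke:
  assumes "\<forall>k\<in>{1..n}. norm (a k) < 1" "z \<in> unit_circle"
  shows "norm (blaschke n a z) = 1"
  using assms(2) by (rule unit_circle_cis) (simp add: blaschke_cis[OF assms(1)])

lemma continuous_on_blaschke:
  assumes "\<forall>k\<in>{1..n}. norm (a k) < 1"
  shows "continuous_on unit_circle (blaschke n a)"
  unfolding blaschke_def
  by (intro continuous_intros ballI blaschke_denominator_nonzero) (use assms in auto)

lemma continuous_on_blaschke_quotient_scale:
  assumes "\<forall>k\<in>{1..n}. norm (a k) < 1" "\<forall>k\<in>{1..m}. norm (b k) < 1"
  shows "continuous_on ({0..1} \<times> unit_circle)
    (\<lambda>(r, z). c * blaschke n (\<lambda>k. of_real r * a k) z / blaschke m (\<lambda>k. of_real r * b k) z)"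
proof -
  have "blaschke m (\<lambda>k. of_real r * b k) z \<noteq> 0" if "r \<in> {0..1}" "z \<in> unit_circle" for r z
    using norm_blaschke[OF norm_scale_less_1[OF assms(2)], of r z] that by auto
  then show ?thesis
    using assms[THEN continuous_on_blaschke_scale] unfolding case_prod_beta
    by (intro continuous_intros) auto
qed

section \<open>Membership in the set and the scaling of zeros\<close>

lemma Blaschke_quotient_homeomorphismsI:
  assumes a: "\<forall>k\<in>{1..Suc m}. norm (a k) < 1" and b: "\<forall>k\<in>{1..m}. norm (b k) < 1"
    and mono: "strict_mono (\<lambda>t. t + Im (blaschke_log (Suc m) a (cis t) - blaschke_log m b (cis t)))"
  shows "(\<lambda>z\<in>unit_circle. cis c * blaschke (Suc m) a z / blaschke m b z)
           \<in> Blaschke_quotient_homeomorphisms"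
proof -
  define L where "L z = blaschke_log (Suc m) a z - blaschke_log m b z" for z
  define \<psi> where "\<psi> t = c + (t + Im (L (cis t)))" for t
  define f where "f = (\<lambda>z\<in>unit_circle. cis c * blaschke (Suc m) a z / blaschke m b z)"
  have "L holomorphic_on cball 0 1"
    unfolding L_def by (intro holomorphic_intros holomorphic_blaschke_log a b)
  then have L: "continuous_on (cball 0 1) L"
    by (rule holomorphic_on_imp_continuous_on)
  have "continuous_on unit_circle (\<lambda>z. cis c * blaschke (Suc m) a z / blaschke m b z)"
    using a b norm_blaschke[OF b]
    by (intro continuous_intros continuous_on_blaschke) force+
  then have "continuous_on unit_circle f"
    unfolding f_def by (rule continuous_on_cong[THEN iffD1, rotated -1]) auto
  moreover have "f (cis t) = cis (\<psi> t)" for t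
    using blaschke_quotient_cis[OF a b, of c t] by (simp add: f_def \<psi>_def L_def add.assoc)
  moreover have "continuous_on UNIV \<psi>"
    unfolding \<psi>_def by (intro continuous_intros continuous_on_compose2[OF L]) auto
  moreover have "strict_mono \<psi>"
    using mono by (simp add: \<psi>_def L_def strict_mono_def)
  moreover have "\<psi> (2 * pi) = \<psi> 0 + 2 * pi"
    unfolding \<psi>_def cis_2pi cis_zero by simp
  ultimately have "sense_preserving_circle_homeomorphism f"
    by (rule sense_preserving_circle_homeomorphismI)
  moreover have "finite_Blaschke_product (\<lambda>z. cis c * blaschke (Suc m) a z)"
    unfolding finite_Blaschke_product_iff using a norm_cis by blast
  moreover have "finite_Blaschke_product (blaschke m b)"
    unfolding finite_Blaschke_product_iff using b
    by (intro exI[of _ m] exI[of _ 1] exI[of _ b]) auto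
  ultimately show ?thesis
    unfolding Blaschke_quotient_homeomorphisms_def f_def by blast
qed

lemma Blaschke_quotient_homeomorphisms_scale:
  assumes f: "sense_preserving_circle_homeomorphism
                (\<lambda>z\<in>unit_circle. cis c * blaschke n a z / blaschke m b z)"
    and a: "\<forall>k\<in>{1..n}. norm (a k) < 1" and b: "\<forall>k\<in>{1..m}. norm (b k) < 1"
  shows "n = Suc m"
    and "\<And>r. \<lbrakk>0 \<le> r; r \<le> 1\<rbrakk> \<Longrightarrow>
      (\<lambda>z\<in>unit_circle. cis c * blaschke n (\<lambda>k. of_real r * a k) z /
        blaschke m (\<lambda>k. of_real r * b k) z) \<in> Blaschke_quotient_homeomorphisms"
proof -
  define L where "L z = blaschke_log n a z - blaschke_log m b z" for z
  define \<psi> where "\<psi> t = c + (real n - real m) * t + Im (L (cis t))" for t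
  have L: "L holomorphic_on cball 0 1"
    unfolding L_def by (intro holomorphic_intros holomorphic_blaschke_log a b)
  have lift: "(\<lambda>z\<in>unit_circle. cis c * blaschke n a z / blaschke m b z) (cis t) = cis (\<psi> t)" for t
    using blaschke_quotient_cis[OF a b, of c t] by (simp add: \<psi>_def L_def)
  have cont: "continuous_on UNIV \<psi>"
    unfolding \<psi>_def
    by (intro continuous_intros continuous_on_compose2[OF holomorphic_on_imp_continuous_on[OF L]])
      auto
  \<comment> \<open>Only the linear term changes over a period. The degree is an integer difference,
    as \<open>n < m\<close> is not yet excluded.\<close>
  have turn: "\<psi> (2 * pi) = \<psi> 0 + 2 * pi * of_int (int n - int m)"
    unfolding \<psi>_def cis_2pi cis_zero by (simp add: algebra_simps)
  note monotone = sense_preserving_circle_homeomorphism_lift[OF f lift cont turn]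
  show n: "n = Suc m"
    using monotone(2) by simp
  have mono: "strict_mono (\<lambda>t. t + Im (L (cis t)))"
    using monotone(1) by (simp add: \<psi>_def n strict_mono_def)
  fix r :: real assume r: "0 \<le> r" "r \<le> 1"
  show "(\<lambda>z\<in>unit_circle. cis c * blaschke n (\<lambda>k. of_real r * a k) z /
        blaschke m (\<lambda>k. of_real r * b k) z) \<in> Blaschke_quotient_homeomorphisms"
    unfolding n
    using norm_scale_less_1[OF a r] norm_scale_less_1[OF b r] strict_mono_lift_shrink[OF L mono r]
    by (intro Blaschke_quotient_homeomorphismsI) (simp_all add: blaschke_log_scale L_def n)
qed

theorem theorem4p3:
  shows "connectedin (mtopology_of C_circle) Blaschke_quotient_homeomorphisms"
proof -
  define R where "R = (\<lambda>\<omega>. \<lambda>z\<in>unit_circle. \<omega> * z) ` unit_circle"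
  \<comment> \<open>All members share the rotations \<open>R\<close>, so their union is connected;
    it remains to put each point of the set into some member.\<close>
  define \<U> where "\<U> = {U. connectedin (mtopology_of C_circle) U \<and> R \<subseteq> U \<and>
    U \<subseteq> Blaschke_quotient_homeomorphisms}"
  have "continuous_on (unit_circle \<times> unit_circle) (\<lambda>(\<omega>, z). \<omega> * z)"
    unfolding case_prod_beta by (intro continuous_intros)
  then have R_connected: "connectedin (mtopology_of C_circle) R"
    unfolding R_def C_circle_def
    by (intro connectedin_cfunspace_image) (simp_all add: connected_sphere)
  have R_subset: "R \<subseteq> Blaschke_quotient_homeomorphisms"
  proof
    fix f assume "f \<in> R"
    then obtain \<omega> where \<omega>: "\<omega> \<in> unit_circle" "f = (\<lambda>z\<in>unit_circle. \<omega> * z)"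
      by (auto simp: R_def)
    obtain c where c: "\<omega> = cis c"
      using \<omega>(1) by (rule unit_circle_cis)
    show "f \<in> Blaschke_quotient_homeomorphisms"
      \<comment> \<open>A rotation is a quotient of degrees 1 and 0 whose only zero is the
        origin.\<close>
      using Blaschke_quotient_homeomorphismsI[of 0 "\<lambda>k. 0" "\<lambda>k. 0" c]
      by (simp add: \<omega>(2) c blaschke_zero blaschke_log_def strict_mono_def)
  qed
  have "\<exists>U\<in>\<U>. f \<in> U" if f: "f \<in> Blaschke_quotient_homeomorphisms" for f
  proof -
    obtain B1 B2 where B: "sense_preserving_circle_homeomorphism f"
      "finite_Blaschke_product B1" "finite_Blaschke_product B2"
      "f = (\<lambda>z\<in>unit_circle. B1 z / B2 z)"
      using f unfolding Blaschke_quotient_homeomorphisms_def by blast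
    obtain n \<sigma> a where a: "norm \<sigma> = 1" "\<forall>k\<in>{1..n}. norm (a k) < 1"
      and B1: "B1 = (\<lambda>z. \<sigma> * blaschke n a z)"
      using B(2) unfolding finite_Blaschke_product_iff by blast
    obtain m \<tau> b where b: "norm \<tau> = 1" "\<forall>k\<in>{1..m}. norm (b k) < 1"
      and B2: "B2 = (\<lambda>z. \<tau> * blaschke m b z)"
      using B(3) unfolding finite_Blaschke_product_iff by blast
    have "\<sigma> / \<tau> \<in> unit_circle"
      using a b by (simp add: norm_divide)
    then obtain c where c: "\<sigma> / \<tau> = cis c"
      by (rule unit_circle_cis)
    define F where "F r z = cis c * blaschke n (\<lambda>k. of_real r * a k) z /
      blaschke m (\<lambda>k. of_real r * b k) z" for r :: real and z
    define P where "P = (\<lambda>r. \<lambda>z\<in>unit_circle. F r z) ` {0..1}"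
    have f_eq: "f = (\<lambda>z\<in>unit_circle. cis c * blaschke n a z / blaschke m b z)"
      unfolding B(4) B1 B2 by (simp flip: c)
    note scale = Blaschke_quotient_homeomorphisms_scale[OF B(1)[unfolded f_eq] a(2) b(2)]
    have "f = (\<lambda>z\<in>unit_circle. F 1 z)"
      by (simp add: f_eq F_def)
    then have fP: "f \<in> P"
      by (auto simp: P_def)
    have P_connected: "connectedin (mtopology_of C_circle) P"
      unfolding P_def C_circle_def F_def
      using continuous_on_blaschke_quotient_scale[OF a(2) b(2)]
      by (intro connectedin_cfunspace_image) auto
    have P_subset: "P \<subseteq> Blaschke_quotient_homeomorphisms"
      using scale(2) by (auto simp: P_def F_def)
    \<comment> \<open>At \<open>r = 0\<close> the quotient is \<open>z ^ Suc m / z ^ m\<close> up to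
      the constant, so the path ends in \<open>R\<close>.\<close>
    have "(\<lambda>z\<in>unit_circle. F 0 z) = (\<lambda>z\<in>unit_circle. cis c * z)"
      using scale(1) by (auto simp: F_def blaschke_zero intro!: restrict_ext)
    then have "(\<lambda>z\<in>unit_circle. cis c * z) \<in> P \<inter> R"
      by (auto simp: P_def R_def intro: image_eqI[where x = 0])
    then have "P \<union> R \<in> \<U>"
      using connectedin_Un[OF P_connected R_connected] P_subset R_subset by (auto simp: \<U>_def)
    then show ?thesis
      using fP by blast
  qed
  then have "Blaschke_quotient_homeomorphisms = \<Union>\<U>"
    by (auto simp: \<U>_def)
  \<comment> \<open>The identity, written as the rotation by 1 to match the form of
    \<open>R\<close>, is the common point needed for the union.\<close>
  moreover have "(\<lambda>z\<in>unit_circle. 1 * z) \<in> \<Inter>\<U>"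
    unfolding \<U>_def R_def by (force simp del: mult_1)
  ultimately show ?thesis
    by (metis (mono_tags, lifting) \<U>_def connectedin_Union empty_iff mem_Collect_eq)
qed

end
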